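(* Let $V$ be a rank one valuation domain with quotient field $K$ and valuation $v$. Let $E=\{s_n\}_{n\in\mathbb{N}}\subset K$ be a pseudo-convergent sequence such that the associated map $w_E$ is a valuation on $K(X)$. If $\overline{w}$ is an extension of $w_E$ to $\overline{K}(X)$ and $u$ is the restriction of $\overline{w}$ to $\overline{K}$, then $\overline{w}$ is equivalent to the extension $\overline{w}_E$ of $w_E$ to $\overline{K}(X)$ along $u$ (or, equivalently, the valuation domain of $\overline{w}$ is equal to the valuation domain $\overline{W}_E$ of $\overline{w}_E$).
   Context: $V$ has rank one and its value group is regarded as a subgroup of $\mathbb{R}$; $\overline{K}$ is an algebraic closure of $K$. A sequence $E=\{s_n\}_{n\in\mathbb{N}}$ in $K$ is pseudo-convergent if $v(s_{n+1}-s_n)<v(s_{n+2}-s_{n+1})$ for all $n$. The map $w_E$ is defined on $K(X)$ by $w_E(\phi)=\lim_{n\to\infty}v(\phi(s_n))$ ($\phi(s_n)$ is defined for all large $n$). If $w_E$ is a valuation and $u$ is an extension of $v$ to $\overline{K}$, the extension of $w_E$ to $\overline{K}(X)$ along $u$ is the valuation $\overline{w}_E(\psi)=\lim_{n\to\infty}u(\psi(s_n))$, for $\psi\in\overline{K}(X)$; its valuation domain is denoted $\overline{W}_E$. Two valuations of a field are equivalent if they have the same valuation domain. *)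

theory Defs
  imports "HOL-Library.Extended_Real" "HOL-Computational_Algebra.Fraction_Field"
    "HOL-Computational_Algebra.Polynomial"
begin

text \<open>
  Valuations are written additively, with \<open>top\<close> as the value of zero. The class constraint on
  the value type is satisfied by \<open>\<Gamma> \<union> {\<infinity>}\<close> for every linearly ordered abelian group \<open>\<Gamma>\<close>;
  conversely, under the conditions below the values of nonzero elements form a linearly
  ordered abelian group, as \<open>w x + w (inverse x) = w 1 = 0\<close>. For the value type \<open>ereal\<close>
  this means that nonzero elements have finite values (in particular never \<open>-\<infinity>\<close>).
\<close>

definition valuation ::
    "('k::field \<Rightarrow> 'v::{linorder, ordered_comm_monoid_add, order_top}) \<Rightarrow> bool" where
  "valuation w \<longleftrightarrow>
     (\<forall>x. w x = top \<longleftrightarrow> x = 0) \<and> w 1 = 0 \<and>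
     (\<forall>x y. w (x * y) = w x + w y) \<and> (\<forall>x y. min (w x) (w y) \<le> w (x + y))"

definition val_domain :: "('k::field \<Rightarrow> 'v::{linorder, ordered_comm_monoid_add}) \<Rightarrow> 'k set" where
  "val_domain w = {x. 0 \<le> w x}"

definition equivalent_valuations ::
    "('k::field \<Rightarrow> 'v::{linorder, ordered_comm_monoid_add, order_top}) \<Rightarrow>
     ('k \<Rightarrow> 'w::{linorder, ordered_comm_monoid_add, order_top}) \<Rightarrow> bool" where
  "equivalent_valuations w w' \<longleftrightarrow> valuation w \<and> valuation w' \<and> val_domain w = val_domain w'"

text \<open>
  A rank one valuation with value group regarded as a (nonzero) subgroup of the reals.
\<close>

definition rank_one_valuation :: "('k::field \<Rightarrow> ereal) \<Rightarrow> bool" where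
  "rank_one_valuation v \<longleftrightarrow> valuation v \<and> (\<exists>x. x \<noteq> 0 \<and> v x \<noteq> 0)"

definition pseudo_convergent :: "('k::field \<Rightarrow> ereal) \<Rightarrow> (nat \<Rightarrow> 'k) \<Rightarrow> bool" where
  "pseudo_convergent v s \<longleftrightarrow>
     (\<forall>n. v (s (n + 1) - s n) < v (s (n + 2) - s (n + 1)))"

definition algebraic_closure_of :: "('k::field \<Rightarrow> 'l::alg_closed_field) \<Rightarrow> bool" where
  "algebraic_closure_of \<iota> \<longleftrightarrow>
     \<iota> 1 = 1 \<and> (\<forall>x y. \<iota> (x + y) = \<iota> x + \<iota> y) \<and> (\<forall>x y. \<iota> (x * y) = \<iota> x * \<iota> y) \<and>
     (\<forall>y. \<exists>p. p \<noteq> 0 \<and> poly (map_poly \<iota> p) y = 0)"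

text \<open>
  The field \<open>K(X)\<close> is \<open>'k poly fract\<close>. The value of a rational function at a point is meaningful
  only if the function has a representation whose denominator does not vanish there; this
  excludes finitely many points for each function.
\<close>

definition ratfun_eval :: "'k::field poly fract \<Rightarrow> 'k \<Rightarrow> 'k" where
  "ratfun_eval \<phi> x =
     (THE y. \<exists>p q. \<phi> = Fract p q \<and> poly q x \<noteq> 0 \<and> y = poly p x / poly q x)"

lemma ratfun_eval_Fract:
  assumes "poly q x \<noteq> 0"
  shows "ratfun_eval (Fract p q) x = poly p x / poly q x"
  unfolding ratfun_eval_def
proof (rule the_equality)
  show "\<exists>p' q'. Fract p q = Fract p' q' \<and> poly q' x \<noteq> 0 \<and>
          poly p x / poly q x = poly p' x / poly q' x"
    using assms by blast
next
  fix y
  assume "\<exists>p' q'. Fract p q = Fract p' q' \<and> poly q' x \<noteq> 0 \<and> y = poly p' x / poly q' x"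
  then obtain p' q' where *: "Fract p q = Fract p' q'" "poly q' x \<noteq> 0"
    "y = poly p' x / poly q' x" by blast
  moreover have "q \<noteq> 0" "q' \<noteq> 0" using assms * by auto
  ultimately have "p * q' = p' * q" by (simp add: eq_fract)
  then have "poly p x * poly q' x = poly p' x * poly q x" by (metis poly_mult)
  then show "y = poly p x / poly q x" using * assms by (simp add: frac_eq_eq)
qed

definition ratfun_const :: "'k::field \<Rightarrow> 'k poly fract" where
  "ratfun_const c = Fract [:c:] 1"

text \<open>
  The embedding of \<open>K(X)\<close> into \<open>L(X)\<close> induced by a field embedding \<open>\<iota>\<close> of \<open>K\<close> into \<open>L\<close>.
\<close>

definition ratfun_map :: "('k::field \<Rightarrow> 'l::field) \<Rightarrow> 'k poly fract \<Rightarrow> 'l poly fract" where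
  "ratfun_map \<iota> \<phi> =
     (THE \<psi>. \<exists>p q. q \<noteq> 0 \<and> \<phi> = Fract p q \<and> \<psi> = Fract (map_poly \<iota> p) (map_poly \<iota> q))"

lemma ratfun_map_Fract:
  assumes \<iota>: "algebraic_closure_of \<iota>" and q: "q \<noteq> 0"
  shows "ratfun_map \<iota> (Fract p q) = Fract (map_poly \<iota> p) (map_poly \<iota> q)"
proof -
  have one: "\<iota> 1 = 1" and add: "\<iota> (x + y) = \<iota> x + \<iota> y" and mult: "\<iota> (x * y) = \<iota> x * \<iota> y" for x y
    using \<iota> by (auto simp: algebraic_closure_of_def)
  have zero: "\<iota> 0 = 0" using add[of 0 0] by (metis add.right_neutral add_left_cancel)
  have sum: "\<iota> (sum f A) = (\<Sum>i\<in>A. \<iota> (f i))" for f and A :: "nat set"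
    by (induction A rule: infinite_finite_induct) (auto simp: zero add)
  have map_mult: "map_poly \<iota> (a * b) = map_poly \<iota> a * map_poly \<iota> b" for a b
    by (rule poly_eqI) (simp add: coeff_map_poly zero coeff_mult sum mult)
  have nz: "\<iota> x \<noteq> 0" if "x \<noteq> 0" for x
    using mult[of x "inverse x"] one that by auto
  have map_nz: "map_poly \<iota> a \<noteq> 0" if "a \<noteq> 0" for a
    using that nz[of "lead_coeff a"] coeff_map_poly[of \<iota> a "degree a", OF zero] by force
  show ?thesis
    unfolding ratfun_map_def
  proof (rule the_equality)
    fix \<psi>
    assume "\<exists>p' q'. q' \<noteq> 0 \<and> Fract p q = Fract p' q' \<and>
              \<psi> = Fract (map_poly \<iota> p') (map_poly \<iota> q')"
    then obtain p' q' where *: "q' \<noteq> 0" "Fract p q = Fract p' q'"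
      "\<psi> = Fract (map_poly \<iota> p') (map_poly \<iota> q')" by blast
    then have "p * q' = p' * q" using q by (simp add: eq_fract)
    then have "map_poly \<iota> p * map_poly \<iota> q' = map_poly \<iota> p' * map_poly \<iota> q"
      by (metis map_mult)
    then show "\<psi> = Fract (map_poly \<iota> p) (map_poly \<iota> q)"
      using * q by (simp add: eq_fract map_nz)
  qed (use q in blast)
qed

text \<open>
  The map \<open>w\<^sub>E\<close> attached to a valuation \<open>v\<close> and a sequence \<open>s\<close>. The terms of a
  pseudo-convergent sequence are pairwise distinct, so all but finitely many of them avoid
  the poles of \<open>\<phi>\<close>.
\<close>

definition limit_map :: "('k::field \<Rightarrow> ereal) \<Rightarrow> (nat \<Rightarrow> 'k) \<Rightarrow> 'k poly fract \<Rightarrow> ereal" where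
  "limit_map v s \<phi> = lim (\<lambda>n. v (ratfun_eval \<phi> (s n)))"

text \<open>
  For a valuation \<open>w\<close> of \<open>L(X)\<close> with arbitrary value group lying over \<open>w\<^sub>E\<close>, the map
  \<open>u\<close> is the real-valued form of the restriction of \<open>w\<close> to \<open>L\<close>: the representative of its
  equivalence class whose restriction to \<open>K\<close> is \<open>v\<close> itself. Only this form makes sense
  of the limit in \<open>limit_map u\<close>.
\<close>

definition real_restriction ::
    "('k::field \<Rightarrow> 'l::field) \<Rightarrow> ('k \<Rightarrow> ereal) \<Rightarrow>
     ('l poly fract \<Rightarrow> 'v::{linorder, ordered_comm_monoid_add, order_top}) \<Rightarrow>
     ('l \<Rightarrow> ereal) \<Rightarrow> bool" where
  "real_restriction \<iota> v w u \<longleftrightarrow>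
     equivalent_valuations u (w \<circ> ratfun_const) \<and> (\<forall>x. u (\<iota> x) = v x)"

end

theory Submission
  imports Defs
begin

text \<open>
  Every element of \<open>L(X)\<close> is algebraic over \<open>K(X)\<close>, so some multiple of its \<open>w\<close>-value is a value
  of \<open>K(X)\<close>. Hence \<open>w\<close> is equivalent to a real-valued \<open>W\<close> extending \<open>w\<^sub>E\<close> itself, and \<open>W\<close> restricts
  on \<open>L\<close> to the only possible \<open>u\<close>. For \<open>\<alpha>\<close> in \<open>L\<close>, the ultrametric inequality gives
  \<open>lim u (s\<^sub>n - \<alpha>) \<le> W (X - \<alpha>)\<close>. Both sides are additive over linear factors, and for a polynomial
  over \<open>K\<close> the total is \<open>w\<^sub>E\<close> on either side; so the inequality is an equality, and \<open>W\<close> agrees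
  with the limit map on all of \<open>L(X)\<close>.
\<close>

section \<open>Valuations\<close>

lemma
  assumes "valuation w"
  shows valuation_eq_top_iff: "w x = top \<longleftrightarrow> x = 0"
    and valuation_one: "w 1 = 0"
    and valuation_mult: "w (x * y) = w x + w y"
    and valuation_add_ge: "min (w x) (w y) \<le> w (x + y)"
  using assms unfolding valuation_def by blast+

lemma valuation_zero: "valuation w \<Longrightarrow> w 0 = top"
  by (simp add: valuation_eq_top_iff)

text \<open>The value of \<open>- 1\<close> doubles to 0, and in an ordered monoid two summands of
  the same sign with sum 0 both vanish; this takes the place of halving.\<close>

lemma valuation_minus:
  assumes "valuation w"
  shows "w (- x) = w x"
proof -
  have *: "w (- 1) + w (- 1) = 0"
    using valuation_mult[OF assms, of "- 1" "- 1"] valuation_one[OF assms] by simp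
  have "w (- 1) = 0"
  proof (cases "0 \<le> w (- 1)")
    case True
    then show ?thesis using * by (simp add: add_nonneg_eq_0_iff)
  next
    case False
    then show ?thesis using * by (simp add: add_nonpos_eq_0_iff)
  qed
  then show ?thesis using valuation_mult[OF assms, of "- 1" x] by simp
qed

lemma valuation_add_eq:
  assumes w: "valuation w" and less: "w x < w y"
  shows "w (x + y) = w x"
proof (rule antisym)
  show "w x \<le> w (x + y)"
    using valuation_add_ge[OF w, of x y] less by (simp add: min_absorb1)
  \<comment> \<open>Here \<open>x\<close> is recovered as \<open>(x + y) - y\<close>; the minimum
    cannot be \<open>w y\<close>, which exceeds \<open>w x\<close>.\<close>
  have "min (w (x + y)) (w y) \<le> w x"
    using valuation_add_ge[OF w, of "x + y" "- y"] by (simp add: valuation_minus[OF w])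
  then show "w (x + y) \<le> w x"
    using less by (auto simp: min_def split: if_splits)
qed

text \<open>The bound \<open>a < top\<close> takes care of the empty sum, whose value is
  \<open>top\<close>.\<close>

lemma valuation_sum_gt:
  assumes w: "valuation w" and "finite A" and "a < top" and "\<And>i. i \<in> A \<Longrightarrow> a < w (f i)"
  shows "a < w (sum f A)"
  using assms(2,4)
proof (induction A rule: finite_induct)
  case empty
  then show ?case using assms(3) by (simp add: valuation_zero[OF w])
next
  case (insert i A)
  have "a < min (w (f i)) (w (sum f A))" using insert by simp
  also have "\<dots> \<le> w (sum f (insert i A))"
    using insert valuation_add_ge[OF w] by simp
  finally show ?case .
qed

text \<open>The least value in a vanishing sum is attained twice: if only \<open>f j\<close>
  attained it, the remaining terms would sum to something of larger value, yet they sum to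
  \<open>- f j\<close>. The nonzero term \<open>f i\<close> keeps the minimum below
  \<open>top\<close>, so both terms obtained are nonzero.\<close>

lemma valuation_sum_eq_0_imp:
  assumes w: "valuation w" and "finite A" and "sum f A = 0" and "i \<in> A" and "f i \<noteq> 0"
  obtains j k where "j \<in> A" "k \<in> A" "j \<noteq> k" "w (f j) = w (f k)" "f j \<noteq> 0" "f k \<noteq> 0"
proof -
  define j where "j = arg_min_on (w \<circ> f) A"
  have j: "j \<in> A" and min: "\<And>k. k \<in> A \<Longrightarrow> w (f j) \<le> w (f k)"
    using arg_min_if_finite(1)[of A "w \<circ> f"] arg_min_least[of A _ "w \<circ> f"] assms(2,4)
    by (auto simp: j_def)
  have top: "w (f j) < top"
    using min[OF assms(4)] assms(5) valuation_eq_top_iff[OF w, of "f i"]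
    by (metis top.not_eq_extremum top_le)
  have "\<exists>k\<in>A - {j}. w (f j) = w (f k)"
  proof (rule ccontr)
    assume "\<not> ?thesis"
    then have "w (f j) < w (sum f (A - {j}))"
      using min top assms(2) by (intro valuation_sum_gt[OF w]) (auto simp: less_le)
    moreover have "sum f (A - {j}) = - f j"
      using assms(2,3) j by (simp add: sum_diff1)
    ultimately show False by (simp add: valuation_minus[OF w])
  qed
  then show ?thesis
    using that[of j] j top valuation_zero[OF w] by fastforce
qed

section \<open>Comparison of values and equivalence of valuations\<close>

lemma valuation_le_iff:
  assumes w: "valuation w" and "x \<noteq> 0"
  shows "w x \<le> w y \<longleftrightarrow> 0 \<le> w (y / x)"
proof
  assume "w x \<le> w y"
  from add_right_mono[OF this, of "w (1 / x)"] show "0 \<le> w (y / x)"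
    using assms valuation_mult[OF w, of x "1 / x"] valuation_mult[OF w, of y "1 / x"]
    by (simp add: valuation_one)
next
  assume "0 \<le> w (y / x)"
  from add_right_mono[OF this, of "w x"] show "w x \<le> w y"
    using assms valuation_mult[OF w, of "y / x" x] by simp
qed

text \<open>The valuation domain determines the order of the values, because comparing
  \<open>x\<close> with \<open>y\<close> amounts to testing whether \<open>y / x\<close> lies in the
  domain. For \<open>x = 0\<close> both sides say that \<open>y = 0\<close>.\<close>

lemma equivalent_valuations_le_iff:
  assumes "equivalent_valuations w w'"
  shows "w x \<le> w y \<longleftrightarrow> w' x \<le> w' y"
proof -
  have w: "valuation w" "valuation w'" and eq: "0 \<le> w z \<longleftrightarrow> 0 \<le> w' z" for z
    using assms by (auto simp: equivalent_valuations_def val_domain_def)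
  show ?thesis
  proof (cases "x = 0")
    case True
    then show ?thesis
      using valuation_eq_top_iff[OF w(1), of y] valuation_eq_top_iff[OF w(2), of y]
      by (simp add: valuation_zero w top_unique)
  next
    case False
    then show ?thesis using eq w by (simp add: valuation_le_iff)
  qed
qed

lemma equivalent_valuations_eq_iff:
  assumes "equivalent_valuations w w'"
  shows "w x = w y \<longleftrightarrow> w' x = w' y"
  using equivalent_valuations_le_iff[OF assms] by (simp add: eq_iff)

lemma equivalent_valuations_sym:
  "equivalent_valuations w w' \<Longrightarrow> equivalent_valuations w' w"
  by (auto simp: equivalent_valuations_def)

lemma equivalent_valuations_trans:
  "equivalent_valuations w w' \<Longrightarrow> equivalent_valuations w' w'' \<Longrightarrow> equivalent_valuations w w''"
  by (auto simp: equivalent_valuations_def)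

lemma valuation_power_cong:
  assumes "valuation w" and "w x = w y"
  shows "w (x ^ n) = w (y ^ n)"
  by (induction n) (simp_all add: valuation_mult assms)

lemma valuation_power_nonneg_iff:
  assumes w: "valuation w" and "0 < n"
  shows "0 \<le> w (x ^ n) \<longleftrightarrow> 0 \<le> w x"
proof
  show "0 \<le> w (x ^ n)" if "0 \<le> w x"
    using that by (induction n) (auto simp: valuation_one[OF w] valuation_mult[OF w])
  \<comment> \<open>Powers of an element of value at most 0 only lose value, so a nonnegative
    \<open>w (x ^ n)\<close> forces a nonnegative \<open>w x\<close>.\<close>
  have "w (x ^ Suc m) \<le> w x" if "w x \<le> 0" for m
    using that
  proof (induction m)
    case (Suc m)
    have "w (x ^ Suc (Suc m)) = w x + w (x ^ Suc m)"
      using valuation_mult[OF w] by simp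
    also have "\<dots> \<le> w x"
      using add_left_mono[OF order.trans[OF Suc.IH Suc.prems], of "w x"] Suc.prems by simp
    finally show ?case .
  qed simp
  moreover obtain m where "n = Suc m" using assms(2) gr0_conv_Suc by blast
  ultimately show "0 \<le> w x" if "0 \<le> w (x ^ n)"
    using that by (metis linear order.trans)
qed

text \<open>A multiplicative map is a valuation as soon as it has the valuation domain of one: the
  ultrametric inequality for \<open>x\<close>, \<open>y\<close> is the closure of the domain under \<open>z \<mapsto> 1 + z\<close>.\<close>

lemma equivalent_valuationsI:
  fixes w' :: "'k::field \<Rightarrow> 'v::{linorder, ordered_comm_monoid_add, order_top}"
  assumes w: "valuation w"
    and top: "\<And>x. w' x = top \<longleftrightarrow> x = 0" and one: "w' 1 = 0"
    and mult: "\<And>x y. w' (x * y) = w' x + w' y"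
    and dom: "\<And>x. 0 \<le> w' x \<longleftrightarrow> 0 \<le> w x"
  shows "equivalent_valuations w' w"
proof -
  have *: "w' x \<le> w' (x + y)" if "w' x \<le> w' y" for x y
  proof (cases "x = 0")
    case True
    then show ?thesis using that by simp
  next
    case False
    have "w' x + w' (1 / x) \<le> w' y + w' (1 / x)" by (rule add_right_mono[OF that])
    then have "0 \<le> w' (y / x)" using False by (simp flip: mult add: one)
    then have "0 \<le> w (1 + y / x)"
      using valuation_add_ge[OF w, of 1 "y / x"] by (auto simp: dom valuation_one[OF w] min_def split: if_splits)
    then have "0 + w' x \<le> w' (1 + y / x) + w' x" by (intro add_right_mono) (simp add: dom)
    moreover have "(1 + y / x) * x = x + y" using False by (simp add: field_simps)
    ultimately show ?thesis by (simp flip: mult)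
  qed
  have "min (w' x) (w' y) \<le> w' (x + y)" for x y
    using *[of x y] *[of y x] by (auto simp: min_def add.commute)
  then show ?thesis
    using assms by (auto simp: equivalent_valuations_def valuation_def val_domain_def)
qed

section \<open>Real-valued valuations\<close>

lemma valuation_ereal_finite:
  fixes v :: "'k::field \<Rightarrow> ereal"
  assumes "valuation v" and "x \<noteq> 0"
  shows "\<bar>v x\<bar> \<noteq> \<infinity>"
proof -
  have "v x + v (1 / x) = 0"
    using valuation_mult[OF assms(1), of x "1 / x"] assms by (simp add: valuation_one)
  moreover have "v x \<noteq> top" "v (1 / x) \<noteq> top"
    using assms by (simp_all add: valuation_eq_top_iff)
  ultimately show ?thesis by (cases "v x"; cases "v (1 / x)") (auto simp: top_ereal_def)
qed

lemma valuation_ereal_power: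
  fixes v :: "'k::field \<Rightarrow> ereal"
  assumes "valuation v" and "x \<noteq> 0"
  shows "real_of_ereal (v (x ^ n)) = n * real_of_ereal (v x)"
proof (induction n)
  case (Suc n)
  have "real_of_ereal (v (x ^ Suc n)) = real_of_ereal (v x) + real_of_ereal (v (x ^ n))"
    using valuation_ereal_finite[OF assms(1), of x] valuation_ereal_finite[OF assms(1), of "x ^ n"] assms
    by (auto simp: valuation_mult[OF assms(1)] real_of_ereal_add)
  then show ?case using Suc by (simp add: algebra_simps)
qed (simp add: valuation_one[OF assms(1)])

section \<open>Field homomorphisms and commensurable values\<close>

text \<open>One locale serves the embeddings of K in L and of K(X) in L(X), as well as those of K
  and L as constants in their function fields.\<close>

locale field_hom =
  fixes h :: "'f::field \<Rightarrow> 'm::field"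
  assumes hom_one: "h 1 = 1"
    and hom_add: "h (x + y) = h x + h y"
    and hom_mult: "h (x * y) = h x * h y"
begin

lemma hom_zero: "h 0 = 0"
  using hom_add[of 0 0] by (metis add.right_neutral add_left_cancel)

lemma hom_eq_0_iff: "h x = 0 \<longleftrightarrow> x = 0"
  using hom_mult[of x "inverse x"] by (cases "x = 0") (auto simp: hom_zero hom_one)

lemma hom_minus: "h (- x) = - h x"
  using hom_add[of x "- x"] by (simp add: hom_zero eq_neg_iff_add_eq_0 add.commute)

lemma hom_power: "h (x ^ n) = h x ^ n"
  by (induction n) (simp_all add: hom_one hom_mult)

lemma hom_divide: "h (x / y) = h x / h y"
proof (cases "y = 0")
  case False
  then show ?thesis using hom_mult[of "x / y" y] by (simp add: hom_eq_0_iff field_simps)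
qed (simp add: hom_zero)

lemma hom_sum: "h (sum f A) = (\<Sum>i\<in>A. h (f i))"
  by (induction A rule: infinite_finite_induct) (auto simp: hom_zero hom_add)

lemma coeff_map_poly_hom: "coeff (map_poly h p) n = h (coeff p n)"
  by (simp add: coeff_map_poly hom_zero)

lemma map_poly_hom_add: "map_poly h (p + q) = map_poly h p + map_poly h q"
  by (rule poly_eqI) (simp add: coeff_map_poly_hom hom_add)

lemma map_poly_hom_mult: "map_poly h (p * q) = map_poly h p * map_poly h q"
  by (rule poly_eqI) (simp add: coeff_map_poly_hom hom_sum hom_mult coeff_mult)

lemma map_poly_hom_pCons: "map_poly h (pCons a p) = pCons (h a) (map_poly h p)"
  by (rule poly_eqI) (simp add: coeff_map_poly_hom coeff_pCons split: nat.splits)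

lemma map_poly_hom_eq_0_iff: "map_poly h p = 0 \<longleftrightarrow> p = 0"
  by (simp add: poly_eq_iff coeff_map_poly_hom hom_eq_0_iff)

lemma poly_map_poly_hom: "poly (map_poly h p) (h x) = h (poly p x)"
  by (induction p) (simp_all add: map_poly_hom_pCons hom_zero hom_add hom_mult)

text \<open>Turns a polynomial that annihilates \<open>a\<close> into one that annihilates X -
  \<open>a\<close>, by a linear substitution.\<close>

lemma poly_map_poly_hom_pcompose:
  "poly (map_poly h (pcompose p q)) y = poly (map_poly h p) (poly (map_poly h q) y)"
  by (induction p)
    (simp_all add: pcompose_pCons map_poly_hom_add map_poly_hom_mult map_poly_hom_pCons)

lemma hom_diff: "h (x - y) = h x - h y"
  using hom_add[of x "- y"] by (simp add: hom_minus)

lemma valuation_hom: "valuation w \<Longrightarrow> valuation (w \<circ> h)"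
  by (simp add: valuation_def hom_one hom_add hom_mult hom_eq_0_iff)

text \<open>Says that the value of \<open>y\<close> is torsion modulo the values of the subfield.
  Powers of \<open>y\<close> express multiples of its value, and \<open>f \<noteq> 0\<close>
  excludes the value \<open>top\<close>.\<close>

definition commensurable ::
    "('m \<Rightarrow> 'v::{linorder, ordered_comm_monoid_add, order_top}) \<Rightarrow> 'm \<Rightarrow> bool" where
  "commensurable w y \<longleftrightarrow> (\<exists>n>0. \<exists>f. f \<noteq> 0 \<and> w (y ^ n) = w (h f))"

text \<open>In the vanishing sum given by the polynomial equation two nonzero terms of different
  degree have the same value; their quotient exhibits a power of \<open>y\<close> with a value from
  the subfield.\<close>

lemma commensurable_algebraic:
  assumes w: "valuation w" and "p \<noteq> 0" and "poly (map_poly h p) y = 0" and "y \<noteq> 0"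
  shows "commensurable w y"
proof -
  let ?t = "\<lambda>i. h (coeff p i) * y ^ i"
  have "sum ?t {..degree (map_poly h p)} = 0"
    using assms(3) by (simp add: poly_altdef coeff_map_poly_hom)
  moreover have "degree (map_poly h p) = degree p"
    by (rule degree_map_poly) (simp add: hom_eq_0_iff)
  moreover have "?t (degree p) \<noteq> 0"
    using assms by (simp add: hom_eq_0_iff)
  ultimately have sum: "sum ?t {..degree p} = 0" and lead: "?t (degree p) \<noteq> 0" by simp_all
  obtain j k where jk: "j \<noteq> k" "w (?t j) = w (?t k)" "?t j \<noteq> 0" "?t k \<noteq> 0"
    by (rule valuation_sum_eq_0_imp[OF w finite_atMost sum _ lead]) (simp, blast)
  have "commensurable w y"
    if "j < k" "w (?t j) = w (?t k)" "?t j \<noteq> 0" "?t k \<noteq> 0" for j k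
  proof -
    \<comment> \<open>This factor moves all coefficients to one term and all powers of
      \<open>y\<close> to the other.\<close>
    let ?z = "1 / (h (coeff p k) * y ^ j)"
    have "?z * ?t j = h (coeff p j / coeff p k)" "?z * ?t k = y ^ (k - j)"
      using that by (simp_all add: hom_divide power_diff)
    moreover have "w (?z * ?t j) = w (?z * ?t k)"
      using that by (simp only: valuation_mult[OF w])
    moreover have "coeff p j / coeff p k \<noteq> 0"
      using that by (auto simp: hom_eq_0_iff)
    ultimately show ?thesis
      unfolding commensurable_def using that(1) by (metis zero_less_diff)
  qed
  from this[of j k] this[of k j] jk show ?thesis by (metis linorder_neqE_nat)
qed

lemma valuation_mult_power_eq:
  assumes w: "valuation w" and "w (y ^ m) = w (h f)" and "w (z ^ n) = w (h g)"
  shows "w ((y * z) ^ (m * n)) = w (h (f ^ n * g ^ m))"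
proof -
  have "w ((y * z) ^ (m * n)) = w ((y ^ m) ^ n * (z ^ n) ^ m)"
    by (simp add: power_mult_distrib flip: power_mult) (simp add: mult.commute)
  also have "\<dots> = w (h (f ^ n * g ^ m))"
    using valuation_power_cong[OF w assms(2), of n] valuation_power_cong[OF w assms(3), of m]
    by (simp add: valuation_mult[OF w] hom_mult hom_power)
  finally show ?thesis .
qed

lemma commensurable_mult:
  assumes w: "valuation w" and "commensurable w y" and "commensurable w z"
  shows "commensurable w (y * z)"
proof -
  obtain m f n g where *: "m > 0" "f \<noteq> 0" "w (y ^ m) = w (h f)"
    "n > 0" "g \<noteq> 0" "w (z ^ n) = w (h g)"
    using assms unfolding commensurable_def by blast
  from valuation_mult_power_eq[OF w *(3) *(6)] show ?thesis
    unfolding commensurable_def using *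
    by (intro exI[of _ "m * n"] conjI exI[of _ "f ^ n * g ^ m"]) simp_all
qed

lemma commensurable_inverse:
  assumes w: "valuation w" and "commensurable w y" and "y \<noteq> 0"
  shows "commensurable w (inverse y)"
proof -
  obtain n f where *: "n > 0" "f \<noteq> 0" "w (y ^ n) = w (h f)"
    using assms unfolding commensurable_def by blast
  \<comment> \<open>Multiplication by this factor sends \<open>y ^ n\<close> to
    \<open>h (1 / f)\<close> and \<open>h f\<close> to \<open>inverse y ^ n\<close>, so the equality
    of values is inverted without subtracting values.\<close>
  let ?z = "1 / (y ^ n * h f)"
  have "w (?z * y ^ n) = w (?z * h f)" using * by (simp only: valuation_mult[OF w])
  moreover have "?z * y ^ n = h (1 / f)" "?z * h f = inverse y ^ n"
    using * assms by (simp_all add: hom_divide hom_one hom_eq_0_iff field_simps)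
  ultimately have "w (inverse y ^ n) = w (h (1 / f))" by simp
  then show ?thesis unfolding commensurable_def
    using * by (intro exI[of _ n] conjI exI[of _ "1 / f"]) simp_all
qed

text \<open>If \<open>y ^ n\<close> has the value of \<open>h f\<close>, the value of
  \<open>y\<close> can only be that of \<open>f\<close> divided by \<open>n\<close>. The resulting
  map is multiplicative and has the domain of \<open>w\<close>, and
  \<open>equivalent_valuationsI\<close> then supplies the ultrametric inequality.\<close>

lemma real_valuation_exists:
  fixes v :: "'f \<Rightarrow> ereal"
  assumes eqv: "equivalent_valuations (w \<circ> h) v" and w: "valuation w"
    and comm: "\<And>y. y \<noteq> 0 \<Longrightarrow> commensurable w y"
  obtains w' :: "'m \<Rightarrow> ereal" where "equivalent_valuations w' w" "w' \<circ> h = v"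
proof -
  have v: "valuation v" using eqv by (simp add: equivalent_valuations_def)
  define r where "r f = real_of_ereal (v f)" for f
  have v_eq: "v f = ereal (r f)" if "f \<noteq> 0" for f
    using valuation_ereal_finite[OF v that] by (auto simp: r_def ereal_real)
  have r_mult: "r (f * g) = r f + r g" if "f \<noteq> 0" "g \<noteq> 0" for f g
    using v_eq[of f] v_eq[of g] v_eq[of "f * g"] valuation_mult[OF v, of f g] that by simp
  have r_power: "r (f ^ n) = n * r f" if "f \<noteq> 0" for f n
    using valuation_ereal_power[OF v that] by (simp add: r_def)
  have r_cong: "r f = r g" if "w (h f) = w (h g)" for f g
    using equivalent_valuations_eq_iff[OF eqv, of f g] that by (simp add: r_def)
  \<comment> \<open>The relation collects all candidates \<open>a\<close> for the new value of
    \<open>y\<close>, over all choices of \<open>n\<close> and \<open>f\<close>.\<close>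
  define rel where "rel y a \<longleftrightarrow> (\<exists>n>0. \<exists>f. f \<noteq> 0 \<and> w (y ^ n) = w (h f) \<and> a = r f / n)" for y a
  have rel_ex: "\<exists>a. rel y a" if "y \<noteq> 0" for y
    using comm[OF that] by (auto simp: commensurable_def rel_def)
  \<comment> \<open>Two witnesses with exponents \<open>m\<close> and \<open>n\<close> are compared
    on \<open>y ^ (m * n)\<close>.\<close>
  have rel_unique: "a = b" if "rel y a" "rel y b" for y a b
  proof -
    obtain m f where 1: "m > 0" "f \<noteq> 0" "w (y ^ m) = w (h f)" "a = r f / m"
      using \<open>rel y a\<close> by (auto simp: rel_def)
    obtain n g where 2: "n > 0" "g \<noteq> 0" "w (y ^ n) = w (h g)" "b = r g / n"
      using \<open>rel y b\<close> by (auto simp: rel_def)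
    have "w (h (f ^ n)) = w ((y ^ m) ^ n)" using valuation_power_cong[OF w 1(3)] by (simp add: hom_power)
    also have "\<dots> = w ((y ^ n) ^ m)" by (simp flip: power_mult add: mult.commute)
    also have "\<dots> = w (h (g ^ m))" using valuation_power_cong[OF w 2(3)] by (simp add: hom_power)
    finally have "n * r f = m * r g" using r_cong r_power 1 2 by metis
    then show ?thesis using 1 2 by (simp add: frac_eq_eq mult.commute)
  qed
  have rel_mult: "rel (y * z) (a + b)" if "rel y a" "rel z b" for y z a b
  proof -
    obtain m f where 1: "m > 0" "f \<noteq> 0" "w (y ^ m) = w (h f)" "a = r f / m"
      using \<open>rel y a\<close> by (auto simp: rel_def)
    obtain n g where 2: "n > 0" "g \<noteq> 0" "w (z ^ n) = w (h g)" "b = r g / n"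
      using \<open>rel z b\<close> by (auto simp: rel_def)
    have "a + b = r (f ^ n * g ^ m) / real (m * n)"
      using 1 2 by (simp add: r_mult r_power field_simps)
    then show ?thesis unfolding rel_def
      using 1 2 valuation_mult_power_eq[OF w 1(3) 2(3)] by (intro exI[of _ "m * n"] conjI exI[of _ "f ^ n * g ^ m"]) simp_all
  qed
  have rel_hom: "rel (h f) (r f)" if "f \<noteq> 0" for f
    unfolding rel_def using that by (intro exI[of _ 1] conjI exI[of _ f]) simp_all
  have rel_nonneg: "0 \<le> a \<longleftrightarrow> 0 \<le> w y" if "rel y a" for y a
  proof -
    obtain m f where 1: "m > 0" "f \<noteq> 0" "w (y ^ m) = w (h f)" "a = r f / m"
      using \<open>rel y a\<close> by (auto simp: rel_def)
    have "0 \<le> a \<longleftrightarrow> 0 \<le> v f" using 1 by (simp add: v_eq zero_le_divide_iff)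
    also have "\<dots> \<longleftrightarrow> 0 \<le> w (h f)"
      using eqv by (auto simp: equivalent_valuations_def val_domain_def)
    also have "\<dots> \<longleftrightarrow> 0 \<le> w y"
      using valuation_power_nonneg_iff[OF w] 1 by metis
    finally show ?thesis .
  qed
  define w' where "w' y = (if y = 0 then \<infinity> else ereal (SOME a. rel y a))" for y
  have w'_eq: "w' y = ereal a" if "rel y a" "y \<noteq> 0" for y a
    using someI[of "rel y", OF that(1)] rel_unique that by (auto simp: w'_def)
  have w'_hom: "w' (h x) = v x" for x
    using w'_eq[OF rel_hom] valuation_zero[OF v]
    by (cases "x = 0") (auto simp: hom_eq_0_iff v_eq w'_def hom_zero top_ereal_def)
  have "equivalent_valuations w' w"
  proof (rule equivalent_valuationsI[OF w])
    show "w' x = top \<longleftrightarrow> x = 0" for x by (auto simp: w'_def top_ereal_def)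
    show "w' 1 = 0" using w'_hom[of 1] by (simp add: hom_one valuation_one[OF v])
    show "w' (x * y) = w' x + w' y" for x y
    proof (cases "x = 0 \<or> y = 0")
      case True
      then show ?thesis by (auto simp: w'_def)
    next
      case False
      then obtain a b where "rel x a" "rel y b" using rel_ex by blast
      then show ?thesis using w'_eq rel_mult False by auto
    qed
    show "0 \<le> w' x \<longleftrightarrow> 0 \<le> w x" for x
    proof (cases "x = 0")
      case True
      then show ?thesis by (simp add: w'_def valuation_zero[OF w])
    next
      case False
      then obtain a where "rel x a" using rel_ex by blast
      then show ?thesis using w'_eq rel_nonneg False by auto
    qed
  qed
  moreover have "w' \<circ> h = v" using w'_hom by auto
  ultimately show ?thesis by (rule that)
qed

text \<open>An equality \<open>u (y ^ n) = u (h f)\<close> passes to \<open>u'\<close> by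
  equivalence. As both maps agree on \<open>h f\<close>, they agree on \<open>y ^ n\<close>, and
  dividing by \<open>n\<close> in the reals they agree on \<open>y\<close>.\<close>

lemma real_valuation_unique:
  fixes u u' :: "'m \<Rightarrow> ereal"
  assumes eqv: "equivalent_valuations u u'" and hom: "u \<circ> h = u' \<circ> h"
    and comm: "\<And>y. y \<noteq> 0 \<Longrightarrow> commensurable u y"
  shows "u = u'"
proof
  fix y
  have u: "valuation u" "valuation u'" using eqv by (auto simp: equivalent_valuations_def)
  show "u y = u' y"
  proof (cases "y = 0")
    case True
    then show ?thesis using u by (simp add: valuation_zero)
  next
    case False
    obtain n f where n: "n > 0" "u (y ^ n) = u (h f)"
      using comm[OF False] by (auto simp: commensurable_def)
    moreover from this have "u' (y ^ n) = u' (h f)"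
      using equivalent_valuations_eq_iff[OF eqv] by blast
    ultimately have "u (y ^ n) = u' (y ^ n)" using fun_cong[OF hom, of f] by simp
    then have "real_of_ereal (u y) = real_of_ereal (u' y)"
      using valuation_ereal_power[OF u(1) False, of n] valuation_ereal_power[OF u(2) False, of n] n
      by simp
    then show ?thesis
      using valuation_ereal_finite[OF u(1) False] valuation_ereal_finite[OF u(2) False]
      by (metis ereal_real)
  qed
qed

end

section \<open>Rational functions over an algebraic closure\<close>

text \<open>Roots are split off one at a time until a constant remains. This form suits properties
  that are stable under products.\<close>

lemma alg_closed_poly_induct [consumes 1, case_names const linear mult]:
  fixes p :: "'l::alg_closed_field poly"
  assumes "p \<noteq> 0"
    and const: "\<And>c. c \<noteq> 0 \<Longrightarrow> P [:c:]"
    and linear: "\<And>a. P [:- a, 1:]"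
    and mult: "\<And>p q. p \<noteq> 0 \<Longrightarrow> q \<noteq> 0 \<Longrightarrow> P p \<Longrightarrow> P q \<Longrightarrow> P (p * q)"
  shows "P p"
  using assms(1)
proof (induction "degree p" arbitrary: p)
  case 0
  then obtain c where "p = [:c:]" by (metis degree_eq_zeroE)
  then show ?case using const 0 by auto
next
  case (Suc n)
  then obtain a where "poly p a = 0" using alg_closed_imp_poly_has_root[of p] by auto
  then obtain q where q: "p = [:- a, 1:] * q" unfolding poly_eq_0_iff_dvd by (elim dvdE)
  then have "q \<noteq> 0" using Suc.prems by auto
  then have "degree p = Suc (degree q)" unfolding q by (subst degree_mult_eq) auto
  then have "P q" using Suc \<open>q \<noteq> 0\<close> by simp
  then show ?case unfolding q using \<open>q \<noteq> 0\<close> by (intro mult linear) auto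
qed

lemma field_hom_algebraic_closure: "algebraic_closure_of \<iota> \<Longrightarrow> field_hom \<iota>"
  by (simp add: algebraic_closure_of_def field_hom_def)

lemma algebraic_closure_of_root:
  assumes "algebraic_closure_of \<iota>"
  obtains p where "p \<noteq> 0" "poly (map_poly \<iota> p) y = 0"
  using assms unfolding algebraic_closure_of_def by blast

lemma field_hom_ratfun_const: "field_hom ratfun_const"
  by standard (simp_all add: ratfun_const_def One_fract_def one_pCons mult.commute)

lemma field_hom_ratfun_map:
  assumes "algebraic_closure_of \<iota>"
  shows "field_hom (ratfun_map \<iota>)"
proof -
  interpret K: field_hom \<iota> by (rule field_hom_algebraic_closure[OF assms])
  note eq = ratfun_map_Fract[OF assms]
  show ?thesis
  proof
    show "ratfun_map \<iota> 1 = 1" by (simp add: One_fract_def eq K.hom_one)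
    fix \<phi> \<psi> :: "'a poly fract"
    obtain p q p' q' where *: "\<phi> = Fract p q" "q \<noteq> 0" "\<psi> = Fract p' q'" "q' \<noteq> 0"
      by (metis Fract_cases)
    then show "ratfun_map \<iota> (\<phi> + \<psi>) = ratfun_map \<iota> \<phi> + ratfun_map \<iota> \<psi>"
      by (simp add: eq K.map_poly_hom_add K.map_poly_hom_mult K.map_poly_hom_eq_0_iff)
    show "ratfun_map \<iota> (\<phi> * \<psi>) = ratfun_map \<iota> \<phi> * ratfun_map \<iota> \<psi>"
      using * by (simp add: eq K.map_poly_hom_mult)
  qed
qed

lemma ratfun_map_polynomial:
  assumes "algebraic_closure_of \<iota>"
  shows "ratfun_map \<iota> (Fract p 1) = Fract (map_poly \<iota> p) 1"
  using assms by (simp add: ratfun_map_Fract algebraic_closure_of_def)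

lemma ratfun_map_const:
  assumes "algebraic_closure_of \<iota>"
  shows "ratfun_map \<iota> (ratfun_const c) = ratfun_const (\<iota> c)"
  using field_hom.map_poly_hom_pCons[OF field_hom_algebraic_closure[OF assms], of c 0]
  by (simp add: ratfun_const_def ratfun_map_polynomial[OF assms])

text \<open>Every nonzero rational function over L is a quotient of products of constants and linear
  polynomials. These factors are algebraic over K(X), and commensurability passes to products and
  inverses.\<close>

lemma commensurable_ratfun:
  fixes \<iota> :: "'k::field \<Rightarrow> 'l::alg_closed_field"
    and w :: "'l poly fract \<Rightarrow> 'v::{linorder, ordered_comm_monoid_add, order_top}"
  assumes \<iota>: "algebraic_closure_of \<iota>" and w: "valuation w" and "\<phi> \<noteq> 0"
  shows "field_hom.commensurable (ratfun_map \<iota>) w \<phi>"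
proof -
  interpret K: field_hom \<iota> by (rule field_hom_algebraic_closure[OF \<iota>])
  interpret R: field_hom "ratfun_map \<iota>" by (rule field_hom_ratfun_map[OF \<iota>])
  interpret CK: field_hom "ratfun_const :: 'k \<Rightarrow> _" by (rule field_hom_ratfun_const)
  interpret CL: field_hom "ratfun_const :: 'l \<Rightarrow> _" by (rule field_hom_ratfun_const)
  \<comment> \<open>A polynomial over K with root \<open>c\<close> is read as a polynomial over K(X)
    with constant coefficients.\<close>
  have root: "\<exists>P. P \<noteq> 0 \<and> poly (map_poly (ratfun_map \<iota>) P) (ratfun_const c) = 0" for c
  proof -
    obtain p where p: "p \<noteq> 0" "poly (map_poly \<iota> p) c = 0"
      using algebraic_closure_of_root[OF \<iota>] by blast
    have "map_poly (ratfun_map \<iota>) (map_poly ratfun_const p) = map_poly ratfun_const (map_poly \<iota> p)"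
      by (rule poly_eqI)
        (simp add: R.coeff_map_poly_hom CK.coeff_map_poly_hom CL.coeff_map_poly_hom
          K.coeff_map_poly_hom ratfun_map_const[OF \<iota>])
    then show ?thesis
      using p by (intro exI[of _ "map_poly ratfun_const p"])
        (simp add: CK.map_poly_hom_eq_0_iff CL.poly_map_poly_hom CL.hom_zero)
  qed
  have const: "R.commensurable w (ratfun_const c)" if "c \<noteq> 0" for c
    using root[of c] that by (auto intro: R.commensurable_algebraic[OF w] simp: CL.hom_eq_0_iff)
  have linear: "R.commensurable w (Fract [:- a, 1:] 1)" for a
  proof -
    obtain P where P: "P \<noteq> 0" "poly (map_poly (ratfun_map \<iota>) P) (ratfun_const a) = 0"
      using root by blast
    let ?X = "Fract [:0, 1:] 1 :: 'k poly fract"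
    \<comment> \<open>This is P(X - T) as a polynomial in T over K(X). At T = X - \<open>a\<close>
      it takes the value P(\<open>a\<close>) = 0, and it is nonzero because the inner polynomial has
      degree one.\<close>
    let ?Q = "pcompose P [:?X, - 1:]"
    have "?Q \<noteq> 0" using P(1) pcompose_eq_0[of P "[:?X, - 1:]"] by auto
    moreover have "poly (map_poly (ratfun_map \<iota>) [:?X, - 1:]) (Fract [:- a, 1:] 1) = ratfun_const a"
      by (simp add: R.map_poly_hom_pCons R.hom_minus R.hom_one ratfun_map_polynomial[OF \<iota>]
          K.map_poly_hom_pCons K.hom_zero K.hom_one ratfun_const_def)
    then have "poly (map_poly (ratfun_map \<iota>) ?Q) (Fract [:- a, 1:] 1) = 0"
      using P(2) by (simp only: R.poly_map_poly_hom_pcompose)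
    ultimately show ?thesis
      by (rule R.commensurable_algebraic[OF w]) (simp add: Zero_fract_def eq_fract)
  qed
  have poly: "R.commensurable w (Fract p 1)" if "p \<noteq> 0" for p
    using that
  proof (induction p rule: alg_closed_poly_induct)
    case (const c)
    then show ?case using \<open>\<And>c. c \<noteq> 0 \<Longrightarrow> R.commensurable w (ratfun_const c)\<close>
      by (simp add: ratfun_const_def)
  next
    case (linear a)
    show ?case by (rule \<open>\<And>a. R.commensurable w (Fract [:- a, 1:] 1)\<close>)
  next
    case (mult p q)
    then show ?case using R.commensurable_mult[OF w, of "Fract p 1" "Fract q 1"] by simp
  qed
  obtain p q where pq: "\<phi> = Fract p q" "q \<noteq> 0" by (cases \<phi>) auto
  then have "p \<noteq> 0" using assms(3) by (auto simp: fract_collapse)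
  moreover have "Fract q 1 \<noteq> 0" using pq by (simp add: Zero_fract_def eq_fract)
  ultimately have "R.commensurable w (Fract p 1 * inverse (Fract q 1))"
    using pq by (intro R.commensurable_mult[OF w] R.commensurable_inverse[OF w] poly)
  then show ?thesis using pq by simp
qed

section \<open>Limits along a pseudo-convergent sequence\<close>

text \<open>The valuation \<open>W\<close> is normalised: on K(X) it is the limit map itself and not
  merely equivalent to it. Hence its values can be compared with limits of values of
  \<open>v\<close>.\<close>

locale limit_extension =
  fixes v :: "'k::field \<Rightarrow> ereal" and s :: "nat \<Rightarrow> 'k"
    and \<iota> :: "'k \<Rightarrow> 'l::alg_closed_field" and W :: "'l poly fract \<Rightarrow> ereal"
  assumes v: "valuation v" and \<iota>: "algebraic_closure_of \<iota>"
    and pseudo_convergent: "pseudo_convergent v s"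
    and W: "valuation W" and W_ratfun_map: "W \<circ> ratfun_map \<iota> = limit_map v s"
begin

sublocale field_hom \<iota> by (rule field_hom_algebraic_closure[OF \<iota>])

abbreviation u :: "'l \<Rightarrow> ereal" where "u \<equiv> W \<circ> ratfun_const"

abbreviation gauge :: "nat \<Rightarrow> ereal" where "gauge n \<equiv> v (s (Suc n) - s n)"

lemma valuation_u: "valuation u"
  by (rule field_hom.valuation_hom[OF field_hom_ratfun_const W])

lemma limit_map_polynomial: "limit_map v s (Fract p 1) = lim (\<lambda>n. v (poly p (s n)))"
  by (simp add: limit_map_def ratfun_eval_Fract)

lemma W_polynomial: "W (Fract (map_poly \<iota> p) 1) = lim (\<lambda>n. v (poly p (s n)))"
  using fun_cong[OF W_ratfun_map, of "Fract p 1"]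
  by (simp add: ratfun_map_polynomial[OF \<iota>] limit_map_polynomial)

lemma W_polynomial_mult: "W (Fract (p * q) 1) = W (Fract p 1) + W (Fract q 1)"
  using valuation_mult[OF W, of "Fract p 1" "Fract q 1"] by simp

lemma W_polynomial_finite: "p \<noteq> 0 \<Longrightarrow> \<bar>W (Fract p 1)\<bar> \<noteq> \<infinity>"
  by (rule valuation_ereal_finite[OF W]) (simp add: Zero_fract_def eq_fract)

lemma u_hom: "u (\<iota> x) = v x"
  using W_polynomial[of "[:x:]"] by (simp add: ratfun_const_def map_poly_hom_pCons)

lemma gauge_mono: "m < n \<Longrightarrow> gauge m < gauge n"
  by (erule lift_Suc_mono_less[rotated])
    (use pseudo_convergent in \<open>simp add: pseudo_convergent_def\<close>)

text \<open>The difference telescopes into successive differences of strictly increasing value, so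
  the first of them decides.\<close>

lemma gauge_eq: "n < m \<Longrightarrow> v (s m - s n) = gauge n"
proof (induction m)
  case (Suc m)
  show ?case
  proof (cases "m = n")
    case False
    then have "v (s m - s n) < v (s (Suc m) - s m)" using Suc gauge_mono by simp
    then show ?thesis using valuation_add_eq[OF v, of "s m - s n" "s (Suc m) - s m"] Suc False by simp
  qed simp
qed simp

lemma W_linear_hom: "W (Fract [:- \<iota> (s n), 1:] 1) = gauge n"
proof -
  have "v (poly [:- s n, 1:] (s m)) = gauge n" if "n < m" for m
    using gauge_eq[OF that] by simp
  then have "(\<lambda>m. v (poly [:- s n, 1:] (s m))) \<longlonglongrightarrow> gauge n"
    by (rule tendsto_eventually[OF eventually_mono[OF eventually_gt_at_top[of n]]])
  then show ?thesis
    using W_polynomial[of "[:- s n, 1:]"] by (simp add: map_poly_hom_pCons hom_minus hom_one limI)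
qed

text \<open>Write X - \<alpha> as the sum of the constant \<open>\<iota> (s n) - \<alpha>\<close>
  and X - \<open>\<iota> (s n)\<close>, whose value is \<open>gauge n\<close>. The two cases are
  whether \<alpha> fails to be a pseudo-limit of the sequence or is one.\<close>

lemma linear_limit_le:
  "\<exists>a::real. (\<lambda>n. u (\<iota> (s n) - \<alpha>)) \<longlonglongrightarrow> ereal a \<and> ereal a \<le> W (Fract [:- \<alpha>, 1:] 1)"
proof -
  have split: "Fract [:- \<alpha>, 1:] 1 = ratfun_const (\<iota> (s n) - \<alpha>) + Fract [:- \<iota> (s n), 1:] 1" for n
    by (simp add: ratfun_const_def)
  have diff: "u (\<iota> (s m) - \<iota> (s n)) = gauge n" if "n < m" for m n
    using gauge_eq[OF that] by (simp only: u_hom flip: hom_diff)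
  have "\<exists>a. (\<lambda>n. u (\<iota> (s n) - \<alpha>)) \<longlonglongrightarrow> a \<and> a \<le> W (Fract [:- \<alpha>, 1:] 1) \<and> a \<noteq> -\<infinity>"
  proof (cases "\<exists>n. u (\<iota> (s n) - \<alpha>) < gauge n")
    case True
    then obtain n where n: "u (\<iota> (s n) - \<alpha>) < gauge n" by blast
    \<comment> \<open>Once the value drops below the gauge, the later terms of the sequence no
      longer change it.\<close>
    have "u (\<iota> (s m) - \<alpha>) = u (\<iota> (s n) - \<alpha>)" if "n < m" for m
      using valuation_add_eq[OF valuation_u, of "\<iota> (s n) - \<alpha>" "\<iota> (s m) - \<iota> (s n)"] n diff[OF that]
      by simp
    then have "(\<lambda>n. u (\<iota> (s n) - \<alpha>)) \<longlonglongrightarrow> u (\<iota> (s n) - \<alpha>)"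
      by (rule tendsto_eventually[OF eventually_mono[OF eventually_gt_at_top[of n]]])
    moreover have "W (Fract [:- \<alpha>, 1:] 1) = u (\<iota> (s n) - \<alpha>)"
      using valuation_add_eq[OF W, of "ratfun_const (\<iota> (s n) - \<alpha>)" "Fract [:- \<iota> (s n), 1:] 1"] n
      by (simp add: W_linear_hom flip: split)
    moreover have "u (\<iota> (s n) - \<alpha>) \<noteq> -\<infinity>"
      using W_polynomial_finite[of "[:- \<alpha>, 1:]"] calculation(2) by auto
    ultimately show ?thesis by (intro exI[of _ "u (\<iota> (s n) - \<alpha>)"]) simp
  next
    case False
    then have ge: "gauge n \<le> u (\<iota> (s n) - \<alpha>)" for n by (simp add: not_less)
    \<comment> \<open>A value above \<open>gauge n\<close> at index \<open>n\<close> would make the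
      value at the next index equal to \<open>gauge n\<close>, which is below the next
      gauge.\<close>
    have eq: "u (\<iota> (s n) - \<alpha>) = gauge n" for n
    proof (rule ccontr)
      assume "u (\<iota> (s n) - \<alpha>) \<noteq> gauge n"
      then have "u (\<iota> (s (Suc n)) - \<iota> (s n)) < u (\<iota> (s n) - \<alpha>)"
        using ge[of n] diff[of n "Suc n"] by simp
      then have "u (\<iota> (s (Suc n)) - \<alpha>) = gauge n"
        using valuation_add_eq[OF valuation_u, of "\<iota> (s (Suc n)) - \<iota> (s n)" "\<iota> (s n) - \<alpha>"]
          diff[of n "Suc n"] by simp
      then show False using ge[of "Suc n"] gauge_mono[of n "Suc n"] by simp
    qed
    have "incseq gauge" using gauge_mono by (intro incseq_SucI less_imp_le) simp
    then have "gauge \<longlonglongrightarrow> (SUP n. gauge n)" by (rule LIMSEQ_SUP)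
    moreover have "(SUP n. gauge n) \<le> W (Fract [:- \<alpha>, 1:] 1)"
    proof (rule SUP_least)
      fix n
      have "min (u (\<iota> (s n) - \<alpha>)) (gauge n) \<le> W (Fract [:- \<alpha>, 1:] 1)"
        using valuation_add_ge[OF W, of "ratfun_const (\<iota> (s n) - \<alpha>)" "Fract [:- \<iota> (s n), 1:] 1"]
        by (simp add: W_linear_hom flip: split)
      then show "gauge n \<le> W (Fract [:- \<alpha>, 1:] 1)" unfolding eq by simp
    qed
    \<comment> \<open>The strict step from index 0 to index 1 keeps the supremum away from
      \<open>-\<infinity>\<close>.\<close>
    moreover have "gauge 0 < gauge 1" "gauge 1 \<le> (SUP n. gauge n)"
      using gauge_mono by (auto intro: SUP_upper)
    then have "(SUP n. gauge n) \<noteq> -\<infinity>" by auto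
    ultimately show ?thesis unfolding eq by blast
  qed
  then obtain a where a: "(\<lambda>n. u (\<iota> (s n) - \<alpha>)) \<longlonglongrightarrow> a" "a \<le> W (Fract [:- \<alpha>, 1:] 1)" "a \<noteq> -\<infinity>"
    by blast
  then have "a \<noteq> \<infinity>" using W_polynomial_finite[of "[:- \<alpha>, 1:]"] by auto
  with a show ?thesis by (cases a) auto
qed

text \<open>The limits are kept real because addition on \<open>ereal\<close> is not continuous at
  pairs of opposite infinities.\<close>

lemma polynomial_limit_mult:
  assumes "(\<lambda>n. u (poly p (\<iota> (s n)))) \<longlonglongrightarrow> ereal a"
    and "(\<lambda>n. u (poly q (\<iota> (s n)))) \<longlonglongrightarrow> ereal b"
  shows "(\<lambda>n. u (poly (p * q) (\<iota> (s n)))) \<longlonglongrightarrow> ereal (a + b)"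
  using tendsto_add_ereal[OF _ _ assms] by (simp add: valuation_mult[OF valuation_u, simplified])

lemma polynomial_limit_le:
  assumes "p \<noteq> 0"
  shows "\<exists>a::real. (\<lambda>n. u (poly p (\<iota> (s n)))) \<longlonglongrightarrow> ereal a \<and> ereal a \<le> W (Fract p 1)"
  using assms
proof (induction p rule: alg_closed_poly_induct)
  case (const c)
  then have "\<bar>u c\<bar> \<noteq> \<infinity>" by (rule valuation_ereal_finite[OF valuation_u])
  then show ?case
    by (intro exI[of _ "real_of_ereal (u c)"]) (auto simp: ratfun_const_def ereal_real)
next
  case (linear \<alpha>)
  then show ?case using linear_limit_le[of \<alpha>] by simp
next
  case (mult p q)
  then obtain a b where ab: "(\<lambda>n. u (poly p (\<iota> (s n)))) \<longlonglongrightarrow> ereal a" "ereal a \<le> W (Fract p 1)"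
    "(\<lambda>n. u (poly q (\<iota> (s n)))) \<longlonglongrightarrow> ereal b" "ereal b \<le> W (Fract q 1)" by blast
  then have "ereal (a + b) \<le> W (Fract (p * q) 1)"
    using add_mono[OF ab(2,4)] by (simp add: W_polynomial_mult)
  then show ?case using polynomial_limit_mult[OF ab(1,3)] by blast
qed

text \<open>Here algebraicity of \<alpha> over K enters: X - \<alpha> divides a polynomial over K,
  whose value under \<open>W\<close> is by normalisation the limit along the sequence.\<close>

lemma linear_limit: "(\<lambda>n. u (\<iota> (s n) - \<alpha>)) \<longlonglongrightarrow> W (Fract [:- \<alpha>, 1:] 1)"
proof -
  obtain p where p: "p \<noteq> 0" "poly (map_poly \<iota> p) \<alpha> = 0"
    using algebraic_closure_of_root[OF \<iota>] by blast
  then obtain q where q: "map_poly \<iota> p = [:- \<alpha>, 1:] * q"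
    unfolding poly_eq_0_iff_dvd by (elim dvdE)
  then have "q \<noteq> 0" using p(1) map_poly_hom_eq_0_iff[of p] by (metis mult_zero_right)
  obtain a where a: "(\<lambda>n. u (\<iota> (s n) - \<alpha>)) \<longlonglongrightarrow> ereal a" "ereal a \<le> W (Fract [:- \<alpha>, 1:] 1)"
    using linear_limit_le by blast
  obtain b where b: "(\<lambda>n. u (poly q (\<iota> (s n)))) \<longlonglongrightarrow> ereal b" "ereal b \<le> W (Fract q 1)"
    using polynomial_limit_le[OF \<open>q \<noteq> 0\<close>] by blast
  have "(\<lambda>n. u (poly (map_poly \<iota> p) (\<iota> (s n)))) \<longlonglongrightarrow> ereal (a + b)"
    unfolding q using polynomial_limit_mult[of "[:- \<alpha>, 1:]" a q b] a b by simp
  then have "(\<lambda>n. v (poly p (s n))) \<longlonglongrightarrow> ereal (a + b)"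
    by (simp only: poly_map_poly_hom u_hom)
  then have "W (Fract (map_poly \<iota> p) 1) = ereal (a + b)" by (simp add: W_polynomial limI)
  then have "W (Fract [:- \<alpha>, 1:] 1) + W (Fract q 1) = ereal a + ereal b"
    by (simp only: q W_polynomial_mult plus_ereal.simps)
  \<comment> \<open>Both summands on the right are at most those on the left and the totals are
    equal and finite, so neither inequality is strict.\<close>
  then have "W (Fract [:- \<alpha>, 1:] 1) = ereal a"
    using a(2) b(2) by (cases "W (Fract [:- \<alpha>, 1:] 1)"; cases "W (Fract q 1)") auto
  then show ?thesis using a(1) by simp
qed

lemma polynomial_limit:
  assumes "p \<noteq> 0"
  shows "(\<lambda>n. u (poly p (\<iota> (s n)))) \<longlonglongrightarrow> W (Fract p 1)"
  using assms
proof (induction p rule: alg_closed_poly_induct)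
  case (const c)
  then show ?case by (simp add: ratfun_const_def)
next
  case (linear \<alpha>)
  then show ?case using linear_limit[of \<alpha>] by simp
next
  case (mult p q)
  obtain a b where "W (Fract p 1) = ereal a" "W (Fract q 1) = ereal b"
    using W_polynomial_finite mult.hyps by (metis ereal_real)
  then show ?case
    using polynomial_limit_mult[of p a q b] mult.IH by (simp only: W_polynomial_mult plus_ereal.simps)
qed

lemma eq_limit_map: "W = limit_map u (\<iota> \<circ> s)"
proof
  fix \<phi> :: "'l poly fract"
  obtain p q where pq: "\<phi> = Fract p q" "q \<noteq> 0" by (cases \<phi>) auto
  show "W \<phi> = limit_map u (\<iota> \<circ> s) \<phi>"
  proof (cases "p = 0")
    case True
    then have "\<phi> = ratfun_const 0" using pq by (simp add: ratfun_const_def fract_collapse)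
    then show ?thesis by (simp add: limit_map_def ratfun_const_def ratfun_eval_Fract)
  next
    case False
    let ?p = "\<lambda>n. poly p (\<iota> (s n))" and ?q = "\<lambda>n. poly q (\<iota> (s n))"
    \<comment> \<open>The values of the denominator tend to a finite limit, so it vanishes at only
      finitely many indices.\<close>
    have "eventually (\<lambda>n. u (?q n) < \<infinity>) sequentially"
      using W_polynomial_finite[OF pq(2)]
      by (intro order_tendstoD(2)[OF polynomial_limit[OF pq(2)]]) auto
    then have "eventually (\<lambda>n. u (?p n) - u (?q n) = u (ratfun_eval \<phi> (\<iota> (s n)))) sequentially"
    proof (rule eventually_mono)
      fix n
      assume "u (?q n) < \<infinity>"
      then have nz: "?q n \<noteq> 0" using valuation_zero[OF valuation_u] by (auto simp: top_ereal_def)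
      then have "u (?p n) = u (?p n / ?q n) + u (?q n)"
        using valuation_mult[OF valuation_u, of "?p n / ?q n" "?q n"] by simp
      then have "u (?p n) - u (?q n) = u (?p n / ?q n)"
        using valuation_ereal_finite[OF valuation_u nz]
        by (cases "u (?q n)"; cases "u (?p n / ?q n)") auto
      then show "u (?p n) - u (?q n) = u (ratfun_eval \<phi> (\<iota> (s n)))"
        using nz pq by (simp add: ratfun_eval_Fract)
    qed
    moreover have "(\<lambda>n. u (?p n) - u (?q n)) \<longlonglongrightarrow> W (Fract p 1) - W (Fract q 1)"
      using polynomial_limit[OF False] polynomial_limit[OF pq(2)] W_polynomial_finite[OF False]
        W_polynomial_finite[OF pq(2)] by (intro tendsto_diff_ereal) auto
    ultimately have "(\<lambda>n. u (ratfun_eval \<phi> (\<iota> (s n)))) \<longlonglongrightarrow> W (Fract p 1) - W (Fract q 1)"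
      by (rule Lim_transform_eventually[rotated])
    moreover have "W (Fract p 1) = W \<phi> + W (Fract q 1)"
      using valuation_mult[OF W, of \<phi> "Fract q 1"] mult_fract_cancel[OF pq(2), of p 1] pq
      by (simp add: mult.commute)
    then have "W (Fract p 1) - W (Fract q 1) = W \<phi>"
      using W_polynomial_finite[OF pq(2)] by (cases "W (Fract q 1)"; cases "W \<phi>") auto
    ultimately show ?thesis by (simp add: limit_map_def limI)
  qed
qed

end

section \<open>Uniqueness of the real form and equivalence with the limit extension\<close>

theorem theorem5p7:
  fixes v :: "'k::field \<Rightarrow> ereal"
    and s :: "nat \<Rightarrow> 'k"
    and \<iota> :: "'k \<Rightarrow> 'l::alg_closed_field"
    and w :: "'l poly fract \<Rightarrow> 'v::{linorder, ordered_comm_monoid_add, order_top}"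
  assumes "rank_one_valuation v"
    and "algebraic_closure_of \<iota>"
    and "pseudo_convergent v s"
    and "valuation (limit_map v s)"
    and "valuation w"
    and "equivalent_valuations (w \<circ> ratfun_map \<iota>) (limit_map v s)"
  shows "(\<exists>!u. real_restriction \<iota> v w u) \<and>
         (\<forall>u. real_restriction \<iota> v w u \<longrightarrow>
            equivalent_valuations w (limit_map u (\<iota> \<circ> s)))"
proof -
  interpret K: field_hom \<iota> by (rule field_hom_algebraic_closure[OF assms(2)])
  interpret R: field_hom "ratfun_map \<iota>" by (rule field_hom_ratfun_map[OF assms(2)])
  obtain W :: "'l poly fract \<Rightarrow> ereal"
    where W_eqv: "equivalent_valuations W w" "W \<circ> ratfun_map \<iota> = limit_map v s"
    using R.real_valuation_exists[OF assms(6,5) commensurable_ratfun[OF assms(2,5)]] by blast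
  interpret limit_extension v s \<iota> W
    using assms(1-3) W_eqv by unfold_locales (auto simp: rank_one_valuation_def equivalent_valuations_def)
  have const: "valuation (w \<circ> ratfun_const)"
    by (rule field_hom.valuation_hom[OF field_hom_ratfun_const assms(5)])
  have "equivalent_valuations u (w \<circ> ratfun_const)"
    using W_eqv(1) valuation_u const by (simp add: equivalent_valuations_def val_domain_def set_eq_iff)
  then have u: "real_restriction \<iota> v w u"
    using u_hom by (simp add: real_restriction_def)
  \<comment> \<open>Any other real form is equivalent to \<open>u\<close> and agrees with it on K;
    since L is algebraic over K, commensurability forces equality.\<close>
  have unique: "u' = u" if "real_restriction \<iota> v w u'" for u'
  proof (rule K.real_valuation_unique)
    show eqv: "equivalent_valuations u' u"
      using u that equivalent_valuations_sym equivalent_valuations_trans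
      unfolding real_restriction_def by blast
    show "u' \<circ> \<iota> = u \<circ> \<iota>"
      using that u by (auto simp: real_restriction_def)
    fix y :: 'l
    assume "y \<noteq> 0"
    moreover obtain p where "p \<noteq> 0" "poly (map_poly \<iota> p) y = 0"
      using algebraic_closure_of_root[OF assms(2)] by blast
    ultimately show "K.commensurable u' y"
      using eqv by (intro K.commensurable_algebraic) (auto simp: equivalent_valuations_def)
  qed
  \<comment> \<open>The limit map along \<open>u\<close> is \<open>W\<close> itself, so this is the
    equivalence of \<open>w\<close> with its real-valued representative.\<close>
  have "equivalent_valuations w (limit_map u (\<iota> \<circ> s))"
    using equivalent_valuations_sym[OF W_eqv(1)] by (simp only: flip: eq_limit_map)
  then show ?thesis using u unique by blast
qed

end
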